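(* Let $j\ge 1$ and $n\ge \sigma_j$ be two integers. Define the integer $r\ge 0$ by $$\sigma_{j+r}-\sigma_r\le n<\sigma_{j+r+1}-\sigma_{r+1}$$ and $n'$ by $$0\le n'=n-(\sigma_{j+r}-\sigma_r)<p_{j+r+1}-p_{r+1}.$$ Then $$h_j(n)\le p_{r+1}p_{r+2}\cdots p_{r+j}\,\frac{p_{j+r+1}}{p_{j+r+1}-n'}=\frac{N_{j+r+1}}{N_r\,(p_{j+r+1}-n')}.$$
   Context: Let $p_i$ denote the $i$-th prime ($p_1=2$). Set $\sigma_0=0$, $N_0=1$, and for $j\ge1$, $\sigma_j=p_1+\dots+p_j$ and $N_j=p_1p_2\cdots p_j$. For a squarefree positive integer $M$, $\ell(M)$ denotes the sum of the prime factors of $M$ (with $\ell(1)=0$) and $\omega(M)$ the number of prime factors of $M$. For integers $j\ge0$ and $n\ge\sigma_j$, $h_j(n)$ is the maximum of all squarefree positive integers $M$ with $\omega(M)=j$ and $\ell(M)\le n$. *)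

theory Defs
  imports Complex_Main "HOL-Computational_Algebra.Computational_Algebra" "HOL-Library.Infinite_Set"
begin

text \<open>The primes are indexed from 1: \<open>pr 1 = 2\<close>, \<open>pr 2 = 3\<close>, and so on; \<^const>\<open>enumerate\<close> starts at 0.
  The value \<open>pr 0\<close> is meaningless and is never used.\<close>

definition pr :: "nat \<Rightarrow> nat" where
  "pr i = enumerate {p. prime p} (i - 1)"

definition prime_sum :: "nat \<Rightarrow> nat" where
  "prime_sum j = (\<Sum>i = 1..j. pr i)"

definition prime_prod :: "nat \<Rightarrow> nat" where
  "prime_prod j = (\<Prod>i = 1..j. pr i)"

text \<open>On squarefree numbers, \<open>ell\<close> is the sum of the prime factors; on other
  numbers (where it is not used) it counts each prime factor once.\<close>

definition ell :: "nat \<Rightarrow> nat" where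
  "ell M = (\<Sum>p \<in> prime_factors M. p)"

definition omega :: "nat \<Rightarrow> nat" where
  "omega M = card (prime_factors M)"

definition h_candidates :: "nat \<Rightarrow> nat \<Rightarrow> nat set" where
  "h_candidates j n = {M. M > 0 \<and> squarefree M \<and> omega M = j \<and> ell M \<le> n}"

text \<open>Only meaningful for \<open>n \<ge> prime_sum j\<close>: then the set is finite and nonempty, as
  \<open>finite_h_candidates\<close> and \<open>h_candidates_nonempty\<close> below show.\<close>

definition h :: "nat \<Rightarrow> nat \<Rightarrow> nat" where
  "h j n = Max (h_candidates j n)"

lemma pr_prime: "prime (pr i)"
  using enumerate_in_set[OF primes_infinite, of "i - 1"] by (simp add: pr_def)

lemma pr_pos: "pr i > 0"
  using pr_prime by (rule prime_gt_0_nat)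

lemma pr_mono: "1 \<le> i \<Longrightarrow> i < k \<Longrightarrow> pr i < pr k"
  unfolding pr_def using primes_infinite by (intro enumerate_mono) auto

lemma pr_inj: "inj_on pr {1..j}"
proof (rule linorder_inj_onI)
  fix x y assume "x < y" "x \<in> {1..j}" "y \<in> {1..j}"
  then show "pr x \<noteq> pr y" using pr_mono[of x y] by simp
qed auto

lemma squarefree_prod_prime_factors:
  assumes "squarefree (M :: nat)"
  shows "\<Prod>(prime_factors M) = M"
proof -
  have M: "M \<noteq> 0" using assms by (metis not_squarefree_0)
  have "M = (\<Prod>p \<in> prime_factors M. p ^ multiplicity p M)"
    using prime_factorization_nat[of M] M by simp
  also have "\<dots> = (\<Prod>p \<in> prime_factors M. p)"
  proof (intro prod.cong refl)
    fix p assume "p \<in> prime_factors M"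
    then have "multiplicity p M = 1"
      using squarefree_factorial_semiring'[OF M] assms by blast
    then show "p ^ multiplicity p M = p" by simp
  qed
  finally show ?thesis by simp
qed

lemma finite_h_candidates: "finite (h_candidates j n)"
proof (rule finite_subset)
  show "h_candidates j n \<subseteq> Prod ` Pow {..n}"
  proof
    fix M assume "M \<in> h_candidates j n"
    then have sq: "squarefree M" and le: "ell M \<le> n" by (auto simp: h_candidates_def)
    have "prime_factors M \<subseteq> {..n}"
    proof
      fix p assume "p \<in> prime_factors M"
      then have "p \<le> ell M" unfolding ell_def by (intro member_le_sum) auto
      with le show "p \<in> {..n}" by simp
    qed
    then show "M \<in> Prod ` Pow {..n}"
      using squarefree_prod_prime_factors[OF sq] by (metis PowI imageI)
  qed
qed simp

lemma h_candidates_nonempty: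
  assumes "prime_sum j \<le> n"
  shows "h_candidates j n \<noteq> {}"
proof -
  have eq: "prime_prod j = (\<Prod>p \<in> pr ` {1..j}. p)"
    unfolding prime_prod_def by (simp only: prod.reindex[OF pr_inj] comp_def id_def)
  have pf: "prime_factors (prime_prod j) = pr ` {1..j}"
    unfolding prime_prod_def
    by (subst prime_factors_prod) (auto simp: prime_prime_factors[OF pr_prime] pr_pos[THEN gr_implies_not0])
  have sq: "squarefree (prime_prod j)"
    unfolding prime_prod_def
  proof (rule squarefree_prod_coprime)
    fix a b assume "a \<in> {1..j}" "b \<in> {1..j}" "a \<noteq> b"
    then have "pr a \<noteq> pr b" using pr_inj[of j] by (auto dest: inj_onD)
    then show "coprime (pr a) (pr b)" by (intro primes_coprime pr_prime)
  qed (use pr_prime squarefree_prime in \<open>auto intro: prime_imp_prime_elem\<close>)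
  have "omega (prime_prod j) = j"
    unfolding omega_def pf by (subst card_image[OF pr_inj]) simp
  moreover have "ell (prime_prod j) = prime_sum j"
    unfolding ell_def pf prime_sum_def by (simp only: sum.reindex[OF pr_inj] comp_def)
  moreover have "prime_prod j > 0"
    using sq by (metis not_squarefree_0 gr0I)
  ultimately have "prime_prod j \<in> h_candidates j n"
    using sq assms by (simp add: h_candidates_def)
  then show ?thesis by blast
qed

text \<open>For given \<open>j\<close> and \<open>n\<close> the differences of prime sums bracket \<open>n\<close> for exactly one shift \<open>r\<close>.\<close>

lemma ex1_shift:
  assumes "1 \<le> j" "prime_sum j \<le> n"
  shows "\<exists>!r. int (prime_sum (j + r)) - int (prime_sum r) \<le> int n \<and>
              int n < int (prime_sum (j + r + 1)) - int (prime_sum (r + 1))"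
proof -
  define f where "f r = int (prime_sum (j + r)) - int (prime_sum r)" for r
  have step: "f r < f (Suc r)" for r
    using pr_mono[of "Suc r" "Suc (j + r)"] assms(1) by (simp add: f_def prime_sum_def)
  then have mono: "strict_mono f" by (simp add: strict_mono_Suc_iff)
  have f0: "f 0 \<le> int n" using assms(2) unfolding f_def by (simp add: prime_sum_def flip: of_nat_sum)
  have ge: "int r \<le> f r" for r
  proof (induction r)
    case 0
    then show ?case by (simp add: f_def prime_sum_def sum_nonneg)
  next
    case (Suc r)
    then show ?case using step[of r] by simp
  qed
  define m where "m = (LEAST r. int n < f (Suc r))"
  have ex: "int n < f (Suc n)" using ge[of "Suc n"] by simp
  have m1: "int n < f (Suc m)" unfolding m_def by (rule LeastI[of _ n]) (rule ex)
  have m0: "f m \<le> int n"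
  proof (cases m)
    case 0
    then show ?thesis using f0 by simp
  next
    case (Suc k)
    then have "\<not> int n < f (Suc k)" unfolding m_def by (intro not_less_Least) simp
    then show ?thesis using Suc by simp
  qed
  have "\<exists>!r. f r \<le> int n \<and> int n < f (Suc r)"
  proof (intro ex1I[of _ m] conjI)
    fix r assume "f r \<le> int n \<and> int n < f (Suc r)"
    then have "f r < f (Suc m)" "f m < f (Suc r)" using m0 m1 by linarith+
    then show "r = m" using mono by (simp add: strict_mono_less)
  qed (use m0 m1 in auto)
  then show ?thesis by (simp add: f_def)
qed

end

theory Submission
  imports Defs
begin

text \<open>
  Let \<open>W\<close> be the window of primes from \<open>L = p\<^bsub>r+1\<^esub>\<close> to \<open>P = p\<^bsub>j+r+1\<^esub>\<close>, put \<open>t = P - n'\<close>, and let \<open>Q\<close>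
  be the set of prime factors of a candidate. Cancelling \<open>Q \<inter> W\<close>, the claim is that
  \<open>t \<cdot> \<Prod>(Q - W) \<le> \<Prod>(W - Q)\<close>, while \<open>t + \<Sum>(Q - W) \<le> \<Sum>(W - Q)\<close>. Here \<open>W - Q\<close> has one element
  more than \<open>Q - W\<close>, and every element of \<open>Q - W\<close> is below \<open>L\<close> or above \<open>P\<close>. If \<open>s\<close> of them are
  below \<open>L\<close>, let \<open>c\<close> be the \<open>(s+1)\<close>-st smallest element of \<open>W - Q\<close>. Pair \<open>t\<close> with \<open>c\<close>, the small
  elements with those below \<open>c\<close> and the large ones with those above \<open>c\<close>. For every pair \<open>(x, a)\<close>
  concavity gives \<open>ln x - ln a \<le> (x - a) / a \<le> (x - a) / c\<close>, and these inequalities add up.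
\<close>

text \<open>Supplies the pivot \<open>c\<close>. In the induction a new maximum changes no count for
  an old element and has all the old elements below itself.\<close>

lemma ex_card_less_eq:
  fixes A :: "'a :: linorder set"
  assumes "finite A" "s < card A"
  shows "\<exists>c\<in>A. card {a \<in> A. a < c} = s"
  using assms
proof (induction A rule: finite_linorder_max_induct)
  case empty
  then show ?case by simp
next
  case (insert m A)
  have m: "m \<notin> A" using insert.hyps by blast
  show ?case
  proof (cases "s < card A")
    case True
    then obtain c where c: "c \<in> A" "card {a \<in> A. a < c} = s" using insert.IH by blast
    moreover have "{a \<in> insert m A. a < c} = {a \<in> A. a < c}"
      using c(1) insert.hyps by fastforce
    ultimately show ?thesis by (intro bexI[of _ c]) simp_all
  next
    case False
    then have "s = card A" using insert.prems insert.hyps(1) m by simp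
    moreover have "{a \<in> insert m A. a < m} = A" using insert.hyps by auto
    ultimately show ?thesis by auto
  qed
qed

text \<open>The tangent of \<open>ln\<close> at \<open>a\<close> has slope 1/a. Passing to slope 1/c
  only raises the bound: for \<open>a \<le> c\<close> the factor \<open>x - a\<close> is
  nonpositive, for \<open>c \<le> a\<close> it is nonnegative. A slope common to all pairs lets the
  bounds be summed.\<close>

lemma ln_diff_le_secant:
  fixes x a c :: real
  assumes "0 < x" "0 < a" "0 < c" "a \<le> c \<and> x \<le> a \<or> c \<le> a \<and> a \<le> x"
  shows "ln x - ln a \<le> (x - a) / c"
proof -
  have "ln x - ln a \<le> (x - a) / a"
    using assms by (intro ln_diff_le)
  also have "\<dots> \<le> (x - a) / c"
    using assms(4)
  proof (elim disjE conjE)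
    assume "a \<le> c" "x \<le> a"
    then show ?thesis using assms by (intro divide_left_mono_neg) auto
  next
    assume "c \<le> a" "a \<le> x"
    then show ?thesis using assms by (intro divide_left_mono) auto
  qed
  finally show ?thesis .
qed

lemma mult_prod_le_prod_of_outside:
  fixes A B :: "real set" and t :: real
  assumes fin: "finite A" "finite B"
    and card: "card A = Suc (card B)"
    and pos: "\<And>a. a \<in> A \<Longrightarrow> 0 < a" "\<And>b. b \<in> B \<Longrightarrow> 0 < b" "0 < t"
    and outside: "\<And>b. b \<in> B \<Longrightarrow> (\<forall>a\<in>A. b \<le> a) \<or> (\<forall>a\<in>A. a \<le> b)"
    and sum: "t + \<Sum>B \<le> \<Sum>A"
  shows "t * \<Prod>B \<le> \<Prod>A"
proof -
  define B1 where "B1 = {b \<in> B. \<forall>a\<in>A. b \<le> a}"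
  have B1: "finite B1" "B1 \<subseteq> B" using fin by (auto simp: B1_def)
  have "card B1 < card A" using card card_mono[OF fin(2) B1(2)] by simp
  then obtain c where c: "c \<in> A" "card {a \<in> A. a < c} = card B1"
    using ex_card_less_eq[OF fin(1)] by blast
  have c0: "0 < c" using pos(1) c(1) by blast
  let ?lo = "{a \<in> A. a < c}" and ?hi = "{a \<in> A. c < a}"
  have split: "A - {c} = ?lo \<union> ?hi" by auto
  have "card (A - {c}) = card ?lo + card ?hi"
    unfolding split using fin by (intro card_Un_disjoint) auto
  then have hi: "card ?hi = card (B - B1)"
    using c card fin B1 by (simp add: card_Diff_subset)
  \<comment> \<open>Arbitrary bijections suffice: elements of \<open>B1\<close> lie below all of
    \<open>A\<close>, and by \<open>outside\<close> the rest of \<open>B\<close> lies above all of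
    \<open>A\<close>.\<close>
  obtain f where f: "bij_betw f ?lo B1"
    using finite_same_card_bij[of ?lo B1] c(2) fin B1 by auto
  obtain g where g: "bij_betw g ?hi (B - B1)"
    using finite_same_card_bij[of ?hi "B - B1"] hi fin by auto
  define k where "k a = (if a < c then f a else g a)" for a
  have k1: "bij_betw k ?lo B1"
    using f by (rule bij_betw_cong[THEN iffD1, rotated]) (auto simp: k_def)
  have k2: "bij_betw k ?hi (B - B1)"
    using g by (rule bij_betw_cong[THEN iffD1, rotated]) (auto simp: k_def)
  have "bij_betw k (A - {c}) (B1 \<union> (B - B1))"
    unfolding split using k1 k2 by (rule bij_betw_combine) auto
  then have k: "bij_betw k (A - {c}) B"
    using B1 by (simp add: Un_absorb1)
  have kB: "k a \<in> B" if "a \<in> A - {c}" for a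
    using k that by (auto simp: bij_betw_def)
  have pair: "ln (k a) - ln a \<le> (k a - a) / c" if a: "a \<in> A - {c}" for a
  proof (rule ln_diff_le_secant)
    show "a \<le> c \<and> k a \<le> a \<or> c \<le> a \<and> a \<le> k a"
    proof (cases "a < c")
      case True
      then have "k a \<in> B1" using a k1 by (auto simp: bij_betw_def)
      then show ?thesis using True a by (auto simp: B1_def)
    next
      case False
      then have "k a \<in> B - B1" using a k2 by (auto simp: bij_betw_def)
      then show ?thesis using False a outside[of "k a"] by (auto simp: B1_def)
    qed
  qed (use a pos kB c0 in auto)
  have prods: "0 < \<Prod>A" "0 < \<Prod>B" using pos by (auto intro: prod_pos)
  have "ln (t * \<Prod>B) - ln (\<Prod>A) = (ln t + (\<Sum>b\<in>B. ln b)) - (\<Sum>a\<in>A. ln a)"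
    using pos fin prods ln_prod[of A "\<lambda>x. x"] ln_prod[of B "\<lambda>x. x"]
    by (simp add: ln_mult_pos order_less_imp_not_eq2)
  also have "(\<Sum>b\<in>B. ln b) = (\<Sum>a\<in>A - {c}. ln (k a))"
    using sum.reindex_bij_betw[OF k, of ln] by simp
  also have "(\<Sum>a\<in>A. ln a) = ln c + (\<Sum>a\<in>A - {c}. ln a)"
    using fin(1) c(1) by (rule sum.remove)
  also have "(ln t + (\<Sum>a\<in>A - {c}. ln (k a))) - (ln c + (\<Sum>a\<in>A - {c}. ln a))
      = (ln t - ln c) + (\<Sum>a\<in>A - {c}. ln (k a) - ln a)"
    by (simp add: sum_subtractf)
  \<comment> \<open>No order between \<open>t\<close> and \<open>c\<close> is required, since the
    tangent at \<open>c\<close> already has slope 1/c.\<close>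
  also have "\<dots> \<le> (t - c) / c + (\<Sum>a\<in>A - {c}. (k a - a) / c)"
    by (intro add_mono sum_mono pair ln_diff_le pos c0)
  also have "\<dots> = (t + (\<Sum>a\<in>A - {c}. k a) - (c + \<Sum>(A - {c}))) / c"
    by (simp add: sum_subtractf sum_divide_distrib[symmetric] diff_divide_distrib add_divide_distrib)
  also have "(\<Sum>a\<in>A - {c}. k a) = \<Sum>B"
    using sum.reindex_bij_betw[OF k, of "\<lambda>x. x"] by simp
  also have "c + \<Sum>(A - {c}) = \<Sum>A"
    using sum.remove[OF fin(1) c(1), of "\<lambda>x. x"] by simp
  also have "(t + \<Sum>B - \<Sum>A) / c \<le> 0"
    using sum c0 by (simp add: divide_le_0_iff)
  finally have "ln (t * \<Prod>B) \<le> ln (\<Prod>A)" by simp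
  then show ?thesis using pos(3) prods by simp
qed

lemma prime_eq_pr:
  assumes "prime q"
  obtains i where "1 \<le> i" "q = pr i"
proof -
  obtain i where "enumerate {p. prime p} i = q"
    using enumerate_Ex[of "{p. prime p}" q] primes_infinite assms by auto
  then show ?thesis using that[of "Suc i"] by (simp add: pr_def)
qed

text \<open>Consecutive indices skip no prime, so a prime outside the window must lie below its
  first or above its last element.\<close>

lemma prime_window:
  assumes "1 \<le> a" "a \<le> b"
  shows "pr ` {a..b} = {q. prime q \<and> pr a \<le> q \<and> q \<le> pr b}"
proof (intro equalityI subsetI)
  fix q assume "q \<in> pr ` {a..b}"
  then obtain i where i: "q = pr i" "a \<le> i" "i \<le> b" by auto
  then have "pr a \<le> pr i" "pr i \<le> pr b"
    using assms pr_mono[of a i] pr_mono[of i b] by (auto simp: le_less)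
  then show "q \<in> {q. prime q \<and> pr a \<le> q \<and> q \<le> pr b}" using i pr_prime by simp
next
  fix q assume q: "q \<in> {q. prime q \<and> pr a \<le> q \<and> q \<le> pr b}"
  then obtain i where i: "1 \<le> i" "q = pr i" using prime_eq_pr by blast
  have "a \<le> i" "i \<le> b"
    using q i assms pr_mono[of i a] pr_mono[of b i] by (auto simp: not_le[symmetric])
  then show "q \<in> pr ` {a..b}" using i by auto
qed

text \<open>The window holds one prime more than a candidate, and \<open>t\<close> takes the extra
  place. Common primes contribute equally to both sums and both products, which leaves only the two
  set differences to compare.\<close>

lemma candidate_mult_le_window:
  assumes M: "M \<in> h_candidates j n"
    and t: "0 < t" "t + real n \<le> real (\<Sum>i = r + 1..j + r + 1. pr i)"
  shows "t * real M \<le> real (\<Prod>i = r + 1..j + r + 1. pr i)"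
proof -
  define W where "W = pr ` {r + 1..j + r + 1}"
  define Q where "Q = prime_factors M"
  have inj: "inj_on pr {r + 1..j + r + 1}"
    using pr_inj by (rule inj_on_subset) auto
  have W: "finite W" "card W = Suc j" unfolding W_def by (simp, subst card_image[OF inj], simp)
  have sumW: "(\<Sum>i = r + 1..j + r + 1. pr i) = \<Sum>W"
    unfolding W_def by (simp only: sum.reindex[OF inj] comp_def)
  have prodW: "(\<Prod>i = r + 1..j + r + 1. pr i) = \<Prod>W"
    unfolding W_def by (simp only: prod.reindex[OF inj] comp_def id_def)
  have Wdef: "W = {q. prime q \<and> pr (r + 1) \<le> q \<and> q \<le> pr (j + r + 1)}"
    unfolding W_def by (rule prime_window) auto
  have Q: "finite Q" "card Q = j" "\<Sum>Q \<le> n" and MQ: "M = \<Prod>Q"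
    using M squarefree_prod_prime_factors[of M]
    by (auto simp: h_candidates_def omega_def ell_def Q_def)
  have prime: "prime q" if "q \<in> Q \<union> W" for q
    using that by (auto simp: Q_def Wdef)
  let ?A = "W - Q" and ?B = "Q - W" and ?C = "W \<inter> Q"
  have splitW: "W = ?A \<union> ?C" and splitQ: "Q = ?B \<union> ?C" by auto
  have sums: "\<Sum>W = \<Sum>?A + \<Sum>?C" "\<Sum>Q = \<Sum>?B + \<Sum>?C"
    using W(1) Q(1) by (subst splitW splitQ, subst sum.union_disjoint; auto)+
  have prods: "\<Prod>W = \<Prod>?A * \<Prod>?C" "\<Prod>Q = \<Prod>?B * \<Prod>?C"
    using W(1) Q(1) by (subst splitW splitQ, subst prod.union_disjoint; auto)+
  have cards: "card W = card ?A + card ?C" "card Q = card ?B + card ?C"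
    using W(1) Q(1) by (subst splitW splitQ, subst card_Un_disjoint; auto)+
  have "t * \<Prod>(real ` ?B) \<le> \<Prod>(real ` ?A)"
  proof (rule mult_prod_le_prod_of_outside)
    show "card (real ` ?A) = Suc (card (real ` ?B))"
      using cards W Q by (simp add: card_image)
    show "(\<forall>a\<in>real ` ?A. b \<le> a) \<or> (\<forall>a\<in>real ` ?A. a \<le> b)" if "b \<in> real ` ?B" for b
    proof -
      obtain q where q: "q \<in> ?B" "b = real q" using \<open>b \<in> real ` ?B\<close> by blast
      then have "q < pr (r + 1) \<or> pr (j + r + 1) < q" using prime[of q] by (auto simp: Wdef)
      then show ?thesis using q(2) by (auto simp: Wdef)
    qed
    have "t + real (\<Sum>?B) \<le> real (\<Sum>?A)"
      using t(2) Q(3) unfolding sumW sums by linarith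
    then show "t + \<Sum>(real ` ?B) \<le> \<Sum>(real ` ?A)"
      by (simp add: sum.reindex)
  qed (use W Q t prime prime_gt_0_nat in auto)
  then have "t * real (\<Prod>?B) \<le> real (\<Prod>?A)"
    by (simp add: prod.reindex)
  then have "t * real (\<Prod>?B) * real (\<Prod>?C) \<le> real (\<Prod>?A) * real (\<Prod>?C)"
    by (rule mult_right_mono) (rule of_nat_0_le_iff)
  then show ?thesis by (simp only: MQ prodW prods of_nat_mult mult.assoc)
qed

theorem proposition4p1:
  fixes j n r :: nat and n' :: int
  assumes "1 \<le> j"
    and "prime_sum j \<le> n"
    and "int (prime_sum (j + r)) - int (prime_sum r) \<le> int n"
    and "int n < int (prime_sum (j + r + 1)) - int (prime_sum (r + 1))"
    and "n' = int n - (int (prime_sum (j + r)) - int (prime_sum r))"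
  shows "0 \<le> n' \<and> n' < int (pr (j + r + 1)) - int (pr (r + 1)) \<and>
    real (h j n) \<le> (\<Prod>i = 1..j. real (pr (r + i))) *
        (real (pr (j + r + 1)) / (real (pr (j + r + 1)) - real_of_int n')) \<and>
    (\<Prod>i = 1..j. real (pr (r + i))) *
        (real (pr (j + r + 1)) / (real (pr (j + r + 1)) - real_of_int n'))
      = real (prime_prod (j + r + 1)) /
        (real (prime_prod r) * (real (pr (j + r + 1)) - real_of_int n'))"
proof -
  define P where "P = real (pr (j + r + 1))"
  define t where "t = P - real_of_int n'"
  define w where "w = (\<Prod>i = 1..j. real (pr (r + i)))"
  have "prime_sum (j + r + 1) = prime_sum r + (\<Sum>i = r + 1..j + r + 1. pr i)"
    unfolding prime_sum_def using sum.ub_add_nat[of 1 r pr "j + 1"] by (simp add: add_ac)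
  then have S: "real (\<Sum>i = r + 1..j + r + 1. pr i)
      = real (prime_sum (j + r + 1)) - real (prime_sum r)" by simp
  have N: "prime_prod (j + r + 1) = prime_prod r * (\<Prod>i = r + 1..j + r + 1. pr i)"
    unfolding prime_prod_def using prod.ub_add_nat[of 1 r pr "j + 1"] by (simp add: add_ac)
  \<comment> \<open>The first \<open>j\<close> primes of the window form the product
    \<open>w\<close> of the bound; its last prime is the numerator \<open>P\<close>.\<close>
  have "(\<Prod>i = r + 1..j + r. pr i) = (\<Prod>i = 1..j. pr (r + i))"
    using prod.shift_bounds_cl_nat_ivl[of pr 1 r j] by (simp add: add_ac)
  then have w: "real (\<Prod>i = r + 1..j + r + 1. pr i) = w * P"
    by (simp add: w_def P_def)
  have steps: "prime_sum (j + r + 1) = prime_sum (j + r) + pr (j + r + 1)"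
    "prime_sum (r + 1) = prime_sum r + pr (r + 1)"
    by (simp_all add: prime_sum_def)
  have n'0: "0 \<le> n'" using assms(3,5) by simp
  have n'1: "n' < int (pr (j + r + 1)) - int (pr (r + 1))" using assms(4,5) steps by simp
  \<comment> \<open>The bound on \<open>n'\<close> even gives \<open>t > pr (r + 1)\<close>.\<close>
  then have t0: "0 < t" unfolding t_def P_def using pr_pos[of "r + 1"] by linarith
  \<comment> \<open>\<open>n'\<close> is the excess of \<open>n\<close> over the sum of the first
    \<open>j\<close> window primes, so \<open>t\<close> is exactly what \<open>n\<close> lacks to
    the sum of all \<open>j + 1\<close>.\<close>
  have "t + real n = real (prime_sum (j + r + 1)) - real (prime_sum r)"
    unfolding t_def P_def using assms(5) steps by simp
  then have tn: "t + real n \<le> real (\<Sum>i = r + 1..j + r + 1. pr i)"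
    using S by simp
  have "h j n \<in> h_candidates j n"
    unfolding h_def using finite_h_candidates h_candidates_nonempty[OF assms(2)] by (rule Max_in)
  from candidate_mult_le_window[OF this t0 tn] have "t * real (h j n) \<le> w * P"
    unfolding w .
  then have bound: "real (h j n) \<le> w * (P / t)"
    using t0 by (simp add: field_simps)
  have "prime_prod r > 0" by (simp add: prime_prod_def pr_pos prod_pos)
  then have "w * (P / t) = real (prime_prod (j + r + 1)) / (real (prime_prod r) * t)"
    unfolding N of_nat_mult w by simp
  with n'0 n'1 bound show ?thesis unfolding w_def P_def t_def by blast
qed

end
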